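(* Let $\mathfrak g$ be a finite-dimensional Lie algebra over $\mathbb K=\mathbb R$ or $\mathbb C$ and let $g$ be an ad-invariant metric on $\mathfrak g$. Then $g$ is solitary if and only if every ad-invariant metric on $\mathfrak g$ is solitary.
   Context: A metric on a Lie algebra $\mathfrak g$ is a nondegenerate symmetric $\mathbb K$-bilinear form $g$; it is ad-invariant if $g([X,Y],Z)=-g(Y,[X,Z])$ for all $X,Y,Z\in\mathfrak g$. A linear map $\phi\colon\mathfrak g\to\mathfrak g$ is ad-invariant if $\phi([X,Y])=[X,\phi(Y)]$ for all $X,Y$. For a linear map $f$, $f^{*_g}$ denotes its adjoint with respect to $g$. An ad-invariant metric $g$ is solitary if every ad-invariant $g$-self-adjoint linear map $\phi\colon\mathfrak g\to\mathfrak g$ can be written as $\phi=D+D^{*_g}$ for some derivation $D$ of $\mathfrak g$. *)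

theory Defs
  imports Complex_Main
begin

locale lie_algebra = vector_space scale
  for scale :: "'k::field \<Rightarrow> 'a::ab_group_add \<Rightarrow> 'a" +
  fixes bracket :: "'a \<Rightarrow> 'a \<Rightarrow> 'a"
  assumes linear_bracket_left: "Vector_Spaces.linear scale scale (\<lambda>X. bracket X Y)"
    and linear_bracket_right: "Vector_Spaces.linear scale scale (\<lambda>Y. bracket X Y)"
    and bracket_self: "bracket X X = 0"
    and jacobi: "bracket X (bracket Y Z) + bracket Y (bracket Z X) + bracket Z (bracket X Y) = 0"
begin

definition metric :: "('a \<Rightarrow> 'a \<Rightarrow> 'k) \<Rightarrow> bool" where
  "metric g \<longleftrightarrow>
     (\<forall>Y. Vector_Spaces.linear scale (*) (\<lambda>X. g X Y)) \<and>
     (\<forall>X. Vector_Spaces.linear scale (*) (\<lambda>Y. g X Y)) \<and>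
     (\<forall>X Y. g X Y = g Y X) \<and>
     (\<forall>X. (\<forall>Y. g X Y = 0) \<longrightarrow> X = 0)"

definition ad_invariant_metric :: "('a \<Rightarrow> 'a \<Rightarrow> 'k) \<Rightarrow> bool" where
  "ad_invariant_metric g \<longleftrightarrow>
     metric g \<and> (\<forall>X Y Z. g (bracket X Y) Z = - g Y (bracket X Z))"

definition ad_invariant_map :: "('a \<Rightarrow> 'a) \<Rightarrow> bool" where
  "ad_invariant_map \<phi> \<longleftrightarrow>
     Vector_Spaces.linear scale scale \<phi> \<and> (\<forall>X Y. \<phi> (bracket X Y) = bracket X (\<phi> Y))"

definition derivation :: "('a \<Rightarrow> 'a) \<Rightarrow> bool" where
  "derivation D \<longleftrightarrow>
     Vector_Spaces.linear scale scale D \<and>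
     (\<forall>X Y. D (bracket X Y) = bracket (D X) Y + bracket X (D Y))"

text \<open>For a metric \<open>g\<close> the described map is unique (and linear) by nondegeneracy; it exists for
  every linear \<open>f\<close> when the Lie algebra is finite-dimensional. Without existence the value is
  unspecified.\<close>

definition metric_adjoint :: "('a \<Rightarrow> 'a \<Rightarrow> 'k) \<Rightarrow> ('a \<Rightarrow> 'a) \<Rightarrow> 'a \<Rightarrow> 'a" where
  "metric_adjoint g f = (THE f'. \<forall>X Y. g (f X) Y = g X (f' Y))"

definition self_adjoint :: "('a \<Rightarrow> 'a \<Rightarrow> 'k) \<Rightarrow> ('a \<Rightarrow> 'a) \<Rightarrow> bool" where
  "self_adjoint g f \<longleftrightarrow> metric_adjoint g f = f"

definition solitary :: "('a \<Rightarrow> 'a \<Rightarrow> 'k) \<Rightarrow> bool" where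
  "solitary g \<longleftrightarrow>
     (\<forall>\<phi>. ad_invariant_map \<phi> \<and> self_adjoint g \<phi> \<longrightarrow>
        (\<exists>D. derivation D \<and> \<phi> = (\<lambda>X. D X + metric_adjoint g D X)))"

end

locale finite_dimensional_lie_algebra = lie_algebra +
  assumes finite_dimensional: "\<exists>Basis. finite_dimensional_vector_space scale Basis"

end

theory Submission
  imports Defs
begin

text \<open>The elements of the centroid, i.e. the ad-invariant maps, act on derivations by composition.
  Two ad-invariant metrics satisfy \<open>h X Y = g (\<psi> X) Y\<close> with \<open>\<psi>\<close> invertible in the centroid. If \<open>\<phi>\<close> is
  ad-invariant and \<open>h\<close>-self-adjoint, then \<open>\<psi> \<circ> \<phi>\<close> is ad-invariant and \<open>g\<close>-self-adjoint, so
  \<open>\<psi> \<circ> \<phi> = D + D\<^sup>*\<close> with the \<open>g\<close>-adjoint of a derivation \<open>D\<close>. Now \<open>\<psi>\<inverse> \<circ> D\<close> is a derivation whose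
  \<open>h\<close>-adjoint is \<open>\<psi>\<inverse> \<circ> D\<^sup>*\<close>, and \<open>\<phi>\<close> is the sum of these two maps.\<close>

context lie_algebra
begin

lemma linear_iff_scale:
  "Vector_Spaces.linear scale scale f \<longleftrightarrow>
     (\<forall>x y. f (x + y) = f x + f y) \<and> (\<forall>c x. f (scale c x) = scale c (f x))"
  using vector_space_axioms by (simp add: Vector_Spaces.linear_iff)

lemma linear_iff_functional:
  "Vector_Spaces.linear scale (*) f \<longleftrightarrow>
     (\<forall>x y. f (x + y) = f x + f y) \<and> (\<forall>c x. f (scale c x) = c * f x)"
  using vector_space_axioms
  by (auto simp: Vector_Spaces.linear_iff vector_space_def algebra_simps)

lemma metric_linear_simps:
  assumes "metric g"
  shows "g (x + y) z = g x z + g y z" "g z (x + y) = g z x + g z y"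
    and "g (scale c x) z = c * g x z" "g z (scale c x) = c * g z x"
  using assms by (simp_all add: metric_def linear_iff_functional)

lemma metric_sym: "metric g \<Longrightarrow> g x y = g y x"
  by (simp add: metric_def)

lemma metric_eqI:
  assumes "metric g" "\<And>z. g x z = g y z"
  shows "x = y"
proof -
  have "g (x - y) z = 0" for z
    using metric_linear_simps(1)[OF assms(1), of "x - y" y z] assms(2)[of z] by simp
  then have "x - y = 0"
    using assms(1) unfolding metric_def by blast
  then show ?thesis by simp
qed

text \<open>Nondegeneracy makes an adjoint unique, so the definite description in
  \<open>metric_adjoint\<close> is evaluated by exhibiting any map with the adjoint
  property.\<close>

lemma metric_adjoint_eqI:
  assumes "metric g" "\<And>X Y. g (f X) Y = g X (f' Y)"
  shows "metric_adjoint g f = f'"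
  unfolding metric_adjoint_def
proof (rule the_equality)
  show "\<forall>X Y. g (f X) Y = g X (f' Y)" using assms(2) by blast
  fix k assume k: "\<forall>X Y. g (f X) Y = g X (k Y)"
  show "k = f'"
  proof
    fix Y
    show "k Y = f' Y"
      by (rule metric_eqI[OF assms(1)]) (metis assms k metric_sym)
  qed
qed

lemma ad_invariant_map_comp:
  "ad_invariant_map \<phi> \<Longrightarrow> ad_invariant_map \<psi> \<Longrightarrow> ad_invariant_map (\<lambda>X. \<phi> (\<psi> X))"
  by (simp add: ad_invariant_map_def linear_iff_scale)

lemma bracket_skew: "bracket X Y = - bracket Y X"
proof -
  \<comment> \<open>Polarisation of \<open>bracket_self\<close>.\<close>
  have "bracket (X + Y) (X + Y) = bracket X Y + bracket Y X"
    using linear_bracket_left linear_bracket_right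
    by (simp add: linear_iff_scale bracket_self[of X] bracket_self[of Y])
  then show ?thesis by (simp add: bracket_self eq_neg_iff_add_eq_0)
qed

text \<open>By skew-symmetry \<open>\<psi>\<close> can be pulled out of either slot of the bracket,
  so it moves onto the factor containing \<open>D\<close> in both terms of the Leibniz rule.\<close>

lemma derivation_ad_invariant_comp:
  assumes "ad_invariant_map \<psi>" "derivation D"
  shows "derivation (\<lambda>X. \<psi> (D X))"
proof -
  have add: "\<psi> (x + y) = \<psi> x + \<psi> y" for x y
    using assms(1) by (simp add: ad_invariant_map_def linear_iff_scale)
  have neg: "\<psi> (- x) = - \<psi> x" for x
    using add[of x "- x"] add[of 0 0] by (simp add: eq_neg_iff_add_eq_0 add.commute)
  have "\<psi> (bracket X Y) = bracket X (\<psi> Y)" for X Y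
    using assms(1) by (simp add: ad_invariant_map_def)
  moreover from this have "\<psi> (bracket X Y) = bracket (\<psi> X) Y" for X Y
    using bracket_skew neg by metis
  ultimately show ?thesis
    using assms add
    unfolding derivation_def ad_invariant_map_def linear_iff_scale
    by metis
qed

end

context finite_dimensional_lie_algebra
begin

text \<open>Riesz representation: this is where finite dimension enters, and it yields both adjoints
  and the map relating two metrics.\<close>

lemma metric_representation:
  assumes g: "metric g" and f: "Vector_Spaces.linear scale (*) f"
  obtains x where "\<And>y. g x y = f y"
proof -
  obtain B where "finite_dimensional_vector_space scale B"
    using finite_dimensional by blast
  then interpret V: finite_dimensional_vector_space scale B .
  \<comment> \<open>The values of \<open>g x\<close> on the basis are reused as coordinates of a
    vector of the same space. This makes \<open>L\<close> an endomorphism, for which injectivity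
    implies surjectivity.\<close>
  define L where "L x = (\<Sum>b\<in>B. scale (g x b) b)" for x
  have unique: "\<forall>b\<in>B. u b = v b"
    if "(\<Sum>b\<in>B. scale (u b) b) = (\<Sum>b\<in>B. scale (v b) b)" for u v
  proof -
    have "(\<Sum>b\<in>B. scale (u b - v b) b) = 0"
      using that by (simp add: scale_left_diff_distrib sum_subtractf)
    then show ?thesis
      using V.independent_Basis V.finite_Basis independentD[of B B "\<lambda>b. u b - v b"] by auto
  qed
  have ext: "p = q"
    if p: "Vector_Spaces.linear scale (*) p" and q: "Vector_Spaces.linear scale (*) q"
      and eq: "\<forall>b\<in>B. p b = q b" for p q
  proof
    fix y
    have "y \<in> span B" using V.span_Basis by simp
    then show "p y = q y"
    proof (induction rule: span_induct_alt)
      case base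
      show ?case using p q by (metis linear_iff_functional mult_zero_left scale_zero_left)
    next
      case (step c x y)
      then show ?case using p q eq by (simp add: linear_iff_functional)
    qed
  qed
  have g_linear: "Vector_Spaces.linear scale (*) (g x)" for x
    using g by (simp add: metric_def)
  have "Vector_Spaces.linear scale scale L"
    by (simp add: linear_iff_scale L_def metric_linear_simps[OF g] scale_left_distrib
        sum.distrib scale_sum_right)
  moreover have "inj L"
  proof (rule injI)
    fix x y assume "L x = L y"
    then have "\<forall>b\<in>B. g x b = g y b" unfolding L_def by (rule unique)
    then have "g x = g y" using ext g_linear by blast
    then show "x = y" using metric_eqI[OF g] by metis
  qed
  ultimately have "surj L"
    by (rule V.linear_inj_imp_surj)
  then obtain x where "L x = (\<Sum>b\<in>B. scale (f b) b)"
    by (metis surjD)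
  then have "\<forall>b\<in>B. g x b = f b" unfolding L_def by (rule unique)
  then have "g x = f" using ext g_linear f by blast
  then show ?thesis using that by metis
qed

text \<open>For fixed \<open>Y\<close> the functional \<open>\<lambda>X. g (f X) Y\<close> is
  represented by some vector; choosing one for each \<open>Y\<close> gives the adjoint.\<close>

lemma metric_adjoint:
  assumes g: "metric g" and f: "Vector_Spaces.linear scale scale f"
  shows "g (f X) Y = g X (metric_adjoint g f Y)"
proof -
  have "\<exists>z. \<forall>X. g (f X) Y = g X z" for Y
  proof -
    have "Vector_Spaces.linear scale (*) (\<lambda>X. g (f X) Y)"
      using f by (simp add: linear_iff_functional linear_iff_scale metric_linear_simps[OF g])
    then obtain z where "\<And>X. g z X = g (f X) Y"
      using metric_representation[OF g] by metis
    then show ?thesis using metric_sym[OF g] by metis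
  qed
  then obtain f' where "\<And>X Y. g (f X) Y = g X (f' Y)"
    by metis
  then show ?thesis using metric_adjoint_eqI[OF g] by metis
qed

lemma ad_invariant_metrics_related:
  assumes g: "ad_invariant_metric g" and h: "ad_invariant_metric h"
  obtains \<psi> where "ad_invariant_map \<psi>" "\<And>X Y. h X Y = g (\<psi> X) Y"
proof -
  have mg: "metric g" and mh: "metric h"
    using g h by (simp_all add: ad_invariant_metric_def)
  have "\<exists>z. \<forall>Y. g z Y = h X Y" for X
    using metric_representation[OF mg, of "h X"] mh by (metis metric_def)
  then obtain \<psi> where \<psi>: "\<And>X Y. g (\<psi> X) Y = h X Y"
    by metis
  have "ad_invariant_map \<psi>"
    unfolding ad_invariant_map_def linear_iff_scale
  proof (intro conjI allI)
    show "\<psi> (x + y) = \<psi> x + \<psi> y" for x y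
      by (rule metric_eqI[OF mg]) (simp add: \<psi> metric_linear_simps[OF mg] metric_linear_simps[OF mh])
    show "\<psi> (scale c x) = scale c (\<psi> x)" for c x
      by (rule metric_eqI[OF mg]) (simp add: \<psi> metric_linear_simps[OF mg] metric_linear_simps[OF mh])
    \<comment> \<open>Paired with Z under g: h([X,Y],Z) = -h(Y,[X,Z]) = -g(\<psi> Y,[X,Z]) =
      g([X,\<psi> Y],Z).\<close>
    show "\<psi> (bracket X Y) = bracket X (\<psi> Y)" for X Y
      using g h by (intro metric_eqI[OF mg]) (simp add: \<psi> ad_invariant_metric_def)
  qed
  then show ?thesis using that \<psi> by metis
qed

lemma solitary_transfer:
  assumes g: "ad_invariant_metric g" and h: "ad_invariant_metric h" and "solitary g"
  shows "solitary h"
  unfolding solitary_def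
proof (intro allI impI)
  fix \<phi> assume \<phi>: "ad_invariant_map \<phi> \<and> self_adjoint h \<phi>"
  have mg: "metric g" and mh: "metric h"
    using g h by (simp_all add: ad_invariant_metric_def)
  obtain \<psi> where \<psi>: "ad_invariant_map \<psi>" "\<And>X Y. h X Y = g (\<psi> X) Y"
    using ad_invariant_metrics_related[OF g h] by metis
  \<comment> \<open>Exchanging the two metrics produces the inverse of \<open>\<psi>\<close>,
    already known to be ad-invariant.\<close>
  obtain \<theta> where \<theta>: "ad_invariant_map \<theta>" "\<And>X Y. g X Y = h (\<theta> X) Y"
    using ad_invariant_metrics_related[OF h g] by metis
  have \<theta>\<psi>: "\<theta> (\<psi> X) = X" for X
    by (rule metric_eqI[OF mh]) (metis \<psi>(2) \<theta>(2))
  have \<phi>_self: "h (\<phi> X) Y = h X (\<phi> Y)" for X Y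
    using metric_adjoint[OF mh, of \<phi>] \<phi> by (simp add: ad_invariant_map_def self_adjoint_def)
  \<comment> \<open>Both sides are values of h: the left is h(\<phi> X,Y), the right is h(X,\<phi>
    Y) by symmetry of g and h.\<close>
  have "g (\<psi> (\<phi> X)) Y = g X (\<psi> (\<phi> Y))" for X Y
    by (metis \<psi>(2) \<phi>_self metric_sym[OF mg] metric_sym[OF mh])
  then have "self_adjoint g (\<lambda>X. \<psi> (\<phi> X))"
    unfolding self_adjoint_def by (intro metric_adjoint_eqI[OF mg])
  moreover have "ad_invariant_map (\<lambda>X. \<psi> (\<phi> X))"
    using \<phi> \<psi>(1) by (simp add: ad_invariant_map_comp)
  ultimately obtain D where D: "derivation D"
    and sum: "(\<lambda>X. \<psi> (\<phi> X)) = (\<lambda>X. D X + metric_adjoint g D X)"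
    using \<open>solitary g\<close> unfolding solitary_def by blast
  have adj: "metric_adjoint h (\<lambda>X. \<theta> (D X)) = (\<lambda>X. \<theta> (metric_adjoint g D X))"
  proof (rule metric_adjoint_eqI[OF mh])
    fix X Y
    have "h (\<theta> (D X)) Y = g X (metric_adjoint g D Y)"
      using metric_adjoint[OF mg, of D] D \<theta>(2) by (simp add: derivation_def)
    \<comment> \<open>By symmetry, g(X,Z) = g(Z,X) = h(\<theta> Z,X) = h(X,\<theta> Z), with Z the
      value of the g-adjoint of \<open>D\<close> at \<open>Y\<close>.\<close>
    also have "\<dots> = h X (\<theta> (metric_adjoint g D Y))"
      by (metis \<theta>(2) metric_sym[OF mg] metric_sym[OF mh])
    finally show "h (\<theta> (D X)) Y = h X (\<theta> (metric_adjoint g D Y))" .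
  qed
  have "\<phi> X = \<theta> (D X) + metric_adjoint h (\<lambda>X. \<theta> (D X)) X" for X
  proof -
    have "\<phi> X = \<theta> (D X + metric_adjoint g D X)"
      using fun_cong[OF sum, of X] \<theta>\<psi> by metis
    then show ?thesis
      using \<theta>(1) by (simp add: adj ad_invariant_map_def linear_iff_scale)
  qed
  then show "\<exists>D. derivation D \<and> \<phi> = (\<lambda>X. D X + metric_adjoint h D X)"
    using derivation_ad_invariant_comp[OF \<theta>(1) D] by blast
qed

end

theorem proposition2p16:
  shows "(\<forall>(scale :: real \<Rightarrow> 'a::ab_group_add \<Rightarrow> 'a) bracket g.
            finite_dimensional_lie_algebra scale bracket \<and>
            lie_algebra.ad_invariant_metric scale bracket g \<longrightarrow>
            (lie_algebra.solitary scale bracket g \<longleftrightarrow>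
              (\<forall>h. lie_algebra.ad_invariant_metric scale bracket h \<longrightarrow>
                   lie_algebra.solitary scale bracket h))) \<and>
         (\<forall>(scale :: complex \<Rightarrow> 'b::ab_group_add \<Rightarrow> 'b) bracket g.
            finite_dimensional_lie_algebra scale bracket \<and>
            lie_algebra.ad_invariant_metric scale bracket g \<longrightarrow>
            (lie_algebra.solitary scale bracket g \<longleftrightarrow>
              (\<forall>h. lie_algebra.ad_invariant_metric scale bracket h \<longrightarrow>
                   lie_algebra.solitary scale bracket h)))"
  \<comment> \<open>One direction is the transfer from g to h; the other takes h = g. The transfer
    holds over any field, which covers both conjuncts.\<close>
  by (intro conjI allI impI iffI)
    (blast intro: finite_dimensional_lie_algebra.solitary_transfer)+

end
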